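(* Let $\Gamma\subset\mathbf{R}^2$ be an asymmetric, strictly convex $C^2$ oval. Then the cylinder $\Gamma\times\mathbf{R}\subset\mathbf{R}^3$ over $\Gamma$ contains a $C^2$ skew loop with nonvanishing curvature.
   Context: A $C^k$ immersed loop ($k\ge1$) is a $C^k$ map from $\mathbf{S}^1\simeq\mathbf{R}/2\pi$ with nowhere-vanishing velocity. A loop $\gamma$ in $\mathbf{R}^3$ is skew if $\gamma'(t)\times\gamma'(s)\neq 0$ for all distinct $t,s\in\mathbf{R}/2\pi$. The tantrix of $\gamma$ is $\tau(t)=\gamma'(t)/\|\gamma'(t)\|$, and the curvature of a $C^2$ immersed loop is the speed $\|\tau'(t)\|$ of its tantrix. A $C^k$ oval is the image $\Gamma=\gamma(\mathbf{S}^1)$ of a $C^k$ (immersed) loop $\gamma\colon\mathbf{S}^1\to\mathbf{R}^2$ that bounds a convex domain. An oval is strictly convex if $\gamma$ is $C^2$ and its curvature never vanishes. It is symmetric if it is invariant under reflection through some point of $\mathbf{R}^2$, and asymmetric otherwise. *)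

theory Defs
  imports "HOL-Analysis.Analysis"
begin

fun C_k :: "nat \<Rightarrow> (real \<Rightarrow> 'a::real_normed_vector) \<Rightarrow> bool" where
  "C_k 0 f \<longleftrightarrow> continuous_on UNIV f"
| "C_k (Suc k) f \<longleftrightarrow>
     (\<forall>t. f differentiable (at t)) \<and> C_k k (\<lambda>t. vector_derivative f (at t))"

abbreviation velocity :: "(real \<Rightarrow> 'a::real_normed_vector) \<Rightarrow> real \<Rightarrow> 'a" where
  "velocity \<gamma> t \<equiv> vector_derivative \<gamma> (at t)"

text \<open>Maps on the circle \<open>\<real>/2\<pi>\<close> are represented by \<open>2\<pi>\<close>-periodic maps on the real line;
  the image of the circle is then \<open>range \<gamma>\<close>.\<close>

definition immersed_loop :: "nat \<Rightarrow> (real \<Rightarrow> 'a::real_normed_vector) \<Rightarrow> bool" where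
  "immersed_loop k \<gamma> \<longleftrightarrow> 1 \<le> k \<and> C_k k \<gamma> \<and> (\<forall>t. \<gamma> (t + 2 * pi) = \<gamma> t)
     \<and> (\<forall>t. velocity \<gamma> t \<noteq> 0)"

definition same_circle_point :: "real \<Rightarrow> real \<Rightarrow> bool" where
  "same_circle_point t s \<longleftrightarrow> (\<exists>n::int. t - s = 2 * pi * of_int n)"

definition skew :: "(real \<Rightarrow> real^3) \<Rightarrow> bool" where
  "skew \<gamma> \<longleftrightarrow>
     (\<forall>t s. \<not> same_circle_point t s \<longrightarrow> cross3 (velocity \<gamma> t) (velocity \<gamma> s) \<noteq> 0)"

definition tantrix :: "(real \<Rightarrow> 'a::real_normed_vector) \<Rightarrow> real \<Rightarrow> 'a" where
  "tantrix \<gamma> t = velocity \<gamma> t /\<^sub>R norm (velocity \<gamma> t)"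

text \<open>The speed of the tantrix is taken with respect to the given parameter, not arclength.\<close>

definition curvature :: "(real \<Rightarrow> 'a::real_normed_vector) \<Rightarrow> real \<Rightarrow> real" where
  "curvature \<gamma> t = norm (velocity (tantrix \<gamma>) t)"

definition bounds_convex_domain :: "(real^2) set \<Rightarrow> bool" where
  "bounds_convex_domain \<Gamma> \<longleftrightarrow>
     (\<exists>D. D \<noteq> {} \<and> open D \<and> bounded D \<and> convex D \<and> frontier D = \<Gamma>)"

text \<open>A parametrization of an oval is not required to be injective on a period.\<close>

definition oval_parametrization :: "nat \<Rightarrow> (real \<Rightarrow> real^2) \<Rightarrow> (real^2) set \<Rightarrow> bool" where
  "oval_parametrization k \<gamma> \<Gamma> \<longleftrightarrow>
     immersed_loop k \<gamma> \<and> range \<gamma> = \<Gamma> \<and> bounds_convex_domain \<Gamma>"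

definition oval :: "nat \<Rightarrow> (real^2) set \<Rightarrow> bool" where
  "oval k \<Gamma> \<longleftrightarrow> (\<exists>\<gamma>. oval_parametrization k \<gamma> \<Gamma>)"

definition strictly_convex_oval :: "(real^2) set \<Rightarrow> bool" where
  "strictly_convex_oval \<Gamma> \<longleftrightarrow>
     (\<exists>\<gamma>. oval_parametrization 2 \<gamma> \<Gamma> \<and> (\<forall>t. curvature \<gamma> t \<noteq> 0))"

definition symmetric :: "(real^2) set \<Rightarrow> bool" where
  "symmetric \<Gamma> \<longleftrightarrow> (\<exists>c. (\<lambda>x. 2 *\<^sub>R c - x) ` \<Gamma> = \<Gamma>)"

text \<open>\<open>\<Gamma> \<times> \<real>\<close> under the identification of \<open>\<real>\<^sup>2 \<times> \<real>\<close> with \<open>\<real>\<^sup>3\<close>.\<close>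

definition cylinder :: "(real^2) set \<Rightarrow> (real^3) set" where
  "cylinder \<Gamma> = {vector [p $ 1, p $ 2, h] | p h. p \<in> \<Gamma>}"

end

theory Submission
  imports Defs
begin

text \<open>Parametrize the oval by its tangent angle, \<open>c' = \<rho> (cos x, sin x)\<close> with \<open>\<rho> > 0\<close>. A curve over it
  with height \<open>h\<close>, \<open>h' = \<rho> f\<close>, has tangent direction \<open>(cos x, sin x, f x)\<close>, so two tangents can only
  be parallel at antipodal angles, and this is excluded as soon as \<open>f x + f (x + \<pi>) > 0\<close>. The height
  closes up iff \<open>\<integral> f \<rho> = 0\<close>. Both conditions can be met exactly because \<open>\<rho>\<close> is not \<open>\<pi>\<close>-periodic, i.e.
  because the oval is asymmetric. Although \<open>\<rho>\<close> is merely continuous, parametrizing the result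
  proportionally to the arclength of \<open>c\<close> makes it \<open>C\<^sup>2\<close>.\<close>

section \<open>Primitives, periodic functions and global inverses on the real line\<close>

lemma real_antiderivative:
  fixes f :: "real \<Rightarrow> real"
  assumes "continuous_on UNIV f"
  obtains F where "\<And>x. (F has_real_derivative f x) (at x)"
proof -
  have "\<exists>F. \<forall>x. - \<infinity> < ereal x \<longrightarrow> ereal x < \<infinity> \<longrightarrow> (F has_vector_derivative f x) (at x)"
    using assms by (intro einterval_antiderivative) (auto simp: continuous_on_eq_continuous_at)
  then show ?thesis
    using that by (auto simp: has_real_derivative_iff_has_vector_derivative)
qed

lemma periodic_add_int:
  fixes f :: "real \<Rightarrow> 'a"
  assumes per: "\<And>x. f (x + p) = f x"
  shows "f (x + p * of_int n) = f x"
proof -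
  have nat: "f (x + p * of_nat n) = f x" for x n
  proof (induction n)
    case (Suc n)
    then show ?case
      using per[of "x + p * of_nat n"] by (simp add: algebra_simps)
  qed simp
  show ?thesis
  proof (cases "n \<ge> 0")
    case True
    then show ?thesis using nat[of x "nat n"] by simp
  next
    case False
    then show ?thesis using nat[of "x + p * of_int n" "nat (- n)"] by simp
  qed
qed

text \<open>The minimum over one compact period is attained, and every point can be moved into that
  period. This turns mere positivity into the uniform bound that \<open>increasing_inverse\<close>
  asks for.\<close>

lemma positive_periodic_bounded_below:
  fixes f :: "real \<Rightarrow> real"
  assumes cont: "continuous_on UNIV f" and pos: "\<And>x. f x > 0"
    and per: "\<And>x. f (x + p) = f x" and "p > 0"
  obtains m where "m > 0" "\<And>x. m \<le> f x"
proof -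
  have "continuous_on {0..p} f"
    using cont continuous_on_subset by blast
  then obtain x0 where x0: "x0 \<in> {0..p}" "\<And>x. x \<in> {0..p} \<Longrightarrow> f x0 \<le> f x"
    using continuous_attains_inf[of "{0..p}" f] \<open>p > 0\<close> by auto
  have "f x0 \<le> f x" for x
  proof -
    have "0 \<le> frac (x / p)" "frac (x / p) \<le> 1"
      using frac_ge_0 frac_lt_1 less_imp_le by blast+
    then have "p * frac (x / p) \<in> {0..p}"
      using \<open>p > 0\<close> by (simp add: mult_left_le)
    then have "f x0 \<le> f (p * frac (x / p))"
      by (rule x0)
    also have "\<dots> = f (p * frac (x / p) + p * of_int \<lfloor>x / p\<rfloor>)"
      using periodic_add_int[of f p, OF per] by simp
    also have "p * frac (x / p) + p * of_int \<lfloor>x / p\<rfloor> = x"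
      using \<open>p > 0\<close> by (simp add: frac_def algebra_simps)
    finally show ?thesis .
  qed
  with pos that show ?thesis by blast
qed

text \<open>A slope of at least \<open>m\<close> makes \<open>f\<close> grow at least linearly in
  both directions, so it is a bijection of the whole line. It is applied to the tangent angle and to
  the rescaled arclength.\<close>

lemma increasing_inverse:
  fixes f k :: "real \<Rightarrow> real"
  assumes der: "\<And>x. (f has_real_derivative k x) (at x)"
    and "m > 0" and low: "\<And>x. m \<le> k x"
  obtains g where "\<And>x. f (g x) = x" "\<And>x. g (f x) = x"
    "\<And>x. (g has_real_derivative inverse (k (g x))) (at x)"
proof -
  have growth: "m * (y - x) \<le> f y - f x" if xy: "x < y" for x y
  proof -
    obtain z where "f y - f x = (y - x) * k z"
      using MVT2[OF xy, of f k] der by blast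
    moreover have "(y - x) * m \<le> (y - x) * k z"
      using xy low by (intro mult_left_mono) auto
    ultimately show ?thesis by (simp add: mult.commute)
  qed
  have cont: "isCont f x" for x
    using der DERIV_isCont by blast
  have "strict_mono f"
    using growth \<open>m > 0\<close> by (intro strict_monoI) (smt (verit) mult_pos_pos)
  then have inj: "inj f"
    by (rule strict_mono_imp_inj_on)
  have "\<exists>x. f x = y" for y
  proof -
    \<comment> \<open>Over a distance \<open>b\<close> the function changes by at least
      \<open>m * b\<close>, which is just enough to get from \<open>f 0\<close> to \<open>y\<close>
      in either direction.\<close>
    define b where "b = \<bar>y - f 0\<bar> / m"
    have "b \<ge> 0" "m * b = \<bar>y - f 0\<bar>"
      using \<open>m > 0\<close> by (auto simp: b_def)
    then have "f (- b) \<le> y" "y \<le> f b"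
      using growth[of 0 b] growth[of "- b" 0] by (cases "b = 0"; auto)+
    then show ?thesis
      using IVT[of f "- b" y b] cont \<open>b \<ge> 0\<close> by auto
  qed
  then have "surj f" by (metis surjI)
  define g where "g = inv f"
  have gf: "g (f x) = x" and fg: "f (g x) = x" for x
    using inj \<open>surj f\<close> by (auto simp: g_def surj_f_inv_f)
  have "isCont g x" for x
    using isCont_inverse_function[of 1 "g x" g f] gf fg cont by auto
  moreover have "k x \<noteq> 0" for x
    using low[of x] \<open>m > 0\<close> by linarith
  ultimately have "(g has_real_derivative inverse (k (g x))) (at x)" for x
    using DERIV_inverse_function[where f = f and g = g and x = x and a = "x - 1" and b = "x + 1"]
      der fg by auto
  with gf fg that show ?thesis by blast
qed

section \<open>Rotating unit vectors in the plane and coordinatewise differentiation\<close>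

text \<open>Both (\<open>u1\<close>, \<open>u2\<close>) and (\<open>cos \<theta>\<close>,
  \<open>sin \<theta>\<close>) rotate with angular speed \<open>k\<close> if \<theta> is a primitive
  of \<open>k\<close>. Their inner product is therefore constant, and it equals 1 once the initial
  angles agree.\<close>

lemma unit_vector_angle:
  fixes u1 u2 k :: "real \<Rightarrow> real"
  assumes cont: "continuous_on UNIV k"
    and d1: "\<And>t. (u1 has_real_derivative - (k t * u2 t)) (at t)"
    and d2: "\<And>t. (u2 has_real_derivative k t * u1 t) (at t)"
    and unit: "\<And>t. (u1 t)\<^sup>2 + (u2 t)\<^sup>2 = 1"
  obtains \<theta> where "\<And>t. (\<theta> has_real_derivative k t) (at t)"
    "\<And>t. u1 t = cos (\<theta> t)" "\<And>t. u2 t = sin (\<theta> t)"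
proof -
  obtain F where F: "\<And>x. (F has_real_derivative k x) (at x)"
    using real_antiderivative[OF cont] by blast
  obtain a where a: "u1 0 = cos a" "u2 0 = sin a"
    using sincos_total_2pi unit by metis
  define \<theta> where "\<theta> t = F t - F 0 + a" for t
  have \<theta>: "(\<theta> has_real_derivative k t) (at t)" for t
    unfolding \<theta>_def by (auto intro!: derivative_eq_intros F)
  define A where "A t = u1 t * cos (\<theta> t) + u2 t * sin (\<theta> t)" for t
  have "(A has_real_derivative 0) (at t)" for t
    unfolding A_def by (rule derivative_eq_intros d1 d2 \<theta> refl)+ (simp add: algebra_simps)
  then have "A t = A 0" for t
    using DERIV_isconst_all by blast
  also have "A 0 = 1"
    using sin_cos_squared_add[of a] by (simp add: A_def \<theta>_def a power2_eq_square)
  finally have A1: "A t = 1" for t .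
  \<comment> \<open>The squared distance of two unit vectors with inner product \<open>A t\<close>
    is \<open>2 - 2 * A t\<close>.\<close>
  have "(u1 t - cos (\<theta> t))\<^sup>2 + (u2 t - sin (\<theta> t))\<^sup>2 = 0" for t
    using A1[of t] unit[of t] sin_cos_squared_add[of "\<theta> t"]
    by (simp add: A_def power2_eq_square algebra_simps)
  then have "u1 t = cos (\<theta> t)" "u2 t = sin (\<theta> t)" for t
    by (auto simp: sum_power2_eq_zero_iff)
  with \<theta> that show ?thesis by blast
qed

lemma nonvanishing_constant_sign:
  fixes k :: "real \<Rightarrow> real"
  assumes cont: "continuous_on UNIV k" and nz: "\<And>t. k t \<noteq> 0"
  shows "(\<forall>t. k t > 0) \<or> (\<forall>t. k t < 0)"
proof -
  have conn: "connected (range k)"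
    using cont connected_continuous_image by blast
  show ?thesis
  proof (rule ccontr)
    assume "\<not> ?thesis"
    then obtain s t where "k s < 0" "k t > 0"
      using nz by (meson linorder_neqE_linordered_idom)
    then have "0 \<in> range k"
      using connectedD_interval[OF conn, of "k s" "k t" 0] by auto
    with nz show False by (metis rangeE)
  qed
qed

text \<open>A normalized vector can only rotate, with angular speed det(v, w) / |v|^2. This is the
  first coordinate of that statement; exchanging the coordinates yields the second, with the sign of
  the determinant reversed.\<close>

lemma normalized_derivative:
  fixes v1 v2 :: "real \<Rightarrow> real"
  assumes d1: "(v1 has_real_derivative w1) (at t)" and d2: "(v2 has_real_derivative w2) (at t)"
    and nz: "(v1 t)\<^sup>2 + (v2 t)\<^sup>2 \<noteq> 0"
  shows "((\<lambda>t. v1 t / sqrt ((v1 t)\<^sup>2 + (v2 t)\<^sup>2)) has_real_derivative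
    - ((v1 t * w2 - v2 t * w1) / ((v1 t)\<^sup>2 + (v2 t)\<^sup>2)
        * (v2 t / sqrt ((v1 t)\<^sup>2 + (v2 t)\<^sup>2)))) (at t)"
proof -
  define r where "r = sqrt ((v1 t)\<^sup>2 + (v2 t)\<^sup>2)"
  have pos: "(v1 t)\<^sup>2 + (v2 t)\<^sup>2 > 0"
    using nz by (metis sum_power2_ge_zero less_eq_real_def)
  then have r: "r > 0" "r\<^sup>2 = (v1 t)\<^sup>2 + (v2 t)\<^sup>2"
    by (auto simp: r_def)
  have dr: "((\<lambda>t. sqrt ((v1 t)\<^sup>2 + (v2 t)\<^sup>2)) has_real_derivative
      (v1 t * w1 + v2 t * w2) / r) (at t)"
  proof -
    have "((\<lambda>t. (v1 t)\<^sup>2 + (v2 t)\<^sup>2) has_real_derivative 2 * (v1 t * w1 + v2 t * w2)) (at t)"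
      by (rule derivative_eq_intros d1 d2 refl)+ (simp add: algebra_simps)
    from DERIV_chain2[OF DERIV_real_sqrt[OF pos] this] show ?thesis
      by (rule DERIV_cong) (use r(1) in \<open>simp add: field_simps flip: r_def\<close>)
  qed
  have num: "r * (r * w1) - v1 t * (v1 t * w1 + v2 t * w2) = - ((v1 t * w2 - v2 t * w1) * v2 t)"
    using r(2) by algebra
  have "(w1 * r - v1 t * ((v1 t * w1 + v2 t * w2) / r)) / (r * r)
      = (r * (r * w1) - v1 t * (v1 t * w1 + v2 t * w2)) / r ^ 3"
    using r(1) by (simp add: field_simps power3_eq_cube)
  also have "\<dots> = - ((v1 t * w2 - v2 t * w1) / r\<^sup>2 * (v2 t / r))"
    unfolding num by (simp add: power3_eq_cube power2_eq_square)
  finally show ?thesis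
    using DERIV_divide[OF d1 dr] r unfolding r_def[symmetric] r(2)[symmetric] by simp
qed

lemma has_vector_derivative_vec_nth:
  fixes f :: "real \<Rightarrow> real^'n"
  assumes "(f has_vector_derivative D) (at t)"
  shows "((\<lambda>t. f t $ i) has_real_derivative D $ i) (at t)"
  using bounded_linear.has_vector_derivative[OF bounded_linear_vec_nth assms]
  by (simp add: has_real_derivative_iff_has_vector_derivative)

lemma has_vector_derivative_vecI:
  fixes f :: "real \<Rightarrow> real^'n"
  assumes "\<And>i. ((\<lambda>t. f t $ i) has_real_derivative D $ i) (at t)"
  shows "(f has_vector_derivative D) (at t)"
  unfolding has_vector_derivative_def
proof (subst has_derivative_componentwise_within, intro ballI)
  fix b :: "real^'n"
  assume "b \<in> Basis"
  then obtain i where "b = axis i 1"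
    by (auto simp: Basis_vec_def)
  then show "((\<lambda>x. f x \<bullet> b) has_derivative (\<lambda>x. (x *\<^sub>R D) \<bullet> b)) (at t)"
    using assms[of i] by (simp add: inner_axis has_field_derivative_def mult_commute_abs)
qed

lemma has_vector_derivative_shift:
  fixes f :: "real \<Rightarrow> 'a::real_normed_vector"
  assumes "(f has_vector_derivative D) (at (x + p))"
  shows "((\<lambda>y. f (y + p)) has_vector_derivative D) (at x)"
proof -
  have "((\<lambda>y. y + p) has_vector_derivative 1) (at x)"
    by (auto intro!: derivative_eq_intros)
  from vector_diff_chain_at[OF this, of f D] assms show ?thesis
    by (simp add: o_def)
qed

lemma velocity_periodic:
  fixes f :: "real \<Rightarrow> 'a::real_normed_vector"
  assumes "\<And>t. f (t + p) = f t" and "f differentiable (at (t + p))"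
  shows "velocity f (t + p) = velocity f t"
proof -
  have "(f has_vector_derivative velocity f (t + p)) (at (t + p))"
    using assms(2) by (simp add: vector_derivative_works)
  from has_vector_derivative_shift[OF this] assms(1) show ?thesis
    by (simp add: vector_derivative_at)
qed

lemma norm_real2: "norm (v :: real^2) = sqrt ((v $ 1)\<^sup>2 + (v $ 2)\<^sup>2)"
  by (simp add: norm_eq_sqrt_inner inner_vec_def sum_2 power2_eq_square)

lemma tantrix_nth: "tantrix \<gamma> t $ i = velocity \<gamma> t $ i / norm (velocity \<gamma> t)"
  for \<gamma> :: "real \<Rightarrow> real^'n"
  by (simp add: tantrix_def divide_inverse_commute)

section \<open>The tangent angle as parameter of the oval, closing up after one turn, and central
  symmetry\<close>

text \<open>The tangent angle of \<gamma> has derivative \<kappa>, which is continuous, periodic and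
  nowhere zero, hence of one sign and bounded away from zero. So the angle is a bijection of the
  line, and its inverse serves as the new parametrization.\<close>

lemma angle_parametrization:
  fixes \<gamma> :: "real \<Rightarrow> real^2"
  assumes loop: "immersed_loop 2 \<gamma>" and curv: "\<And>t. curvature \<gamma> t \<noteq> 0"
  obtains c :: "real \<Rightarrow> real^2" and \<rho> where "continuous_on UNIV \<rho>" "\<And>x. \<rho> x > 0"
    "\<And>x. ((\<lambda>x. c x $ 1) has_real_derivative \<rho> x * cos x) (at x)"
    "\<And>x. ((\<lambda>x. c x $ 2) has_real_derivative \<rho> x * sin x) (at x)"
    "range c = range \<gamma>"
proof -
  define v where "v = velocity \<gamma>"
  define w where "w = velocity v"
  have "C_k (Suc (Suc 0)) \<gamma>" and per: "\<And>t. \<gamma> (t + 2 * pi) = \<gamma> t" and v0: "\<And>t. v t \<noteq> 0"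
    using loop by (auto simp: immersed_loop_def numeral_2_eq_2 v_def)
  then have diff: "\<And>t. \<gamma> differentiable (at t)" "\<And>t. v differentiable (at t)"
    and w: "continuous_on UNIV w"
    by (auto simp: v_def w_def)
  have hv: "(\<gamma> has_vector_derivative v t) (at t)" and hw: "(v has_vector_derivative w t) (at t)" for t
    using diff by (auto simp: v_def w_def vector_derivative_works)
  have vper: "v (t + 2 * pi) = v t" for t
    unfolding v_def using velocity_periodic per diff(1) by blast
  have wper: "w (t + 2 * pi) = w t" for t
    unfolding w_def using velocity_periodic vper diff(2) by blast
  have vcont: "continuous_on UNIV v"
    using hw by (meson continuous_at_imp_continuous_on has_vector_derivative_continuous)
  define N where "N t = norm (v t)" for t
  have N: "N t > 0" "(N t)\<^sup>2 = (v t $ 1)\<^sup>2 + (v t $ 2)\<^sup>2"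
    "N t = sqrt ((v t $ 1)\<^sup>2 + (v t $ 2)\<^sup>2)" for t
  proof -
    show "N t > 0"
      using v0 by (simp add: N_def)
    show "N t = sqrt ((v t $ 1)\<^sup>2 + (v t $ 2)\<^sup>2)"
      by (simp only: N_def norm_real2)
    then show "(N t)\<^sup>2 = (v t $ 1)\<^sup>2 + (v t $ 2)\<^sup>2"
      by simp
  qed
  \<comment> \<open>The signed angular speed of the tantrix; its absolute value is the
    curvature.\<close>
  define \<kappa> where "\<kappa> t = (v t $ 1 * w t $ 2 - v t $ 2 * w t $ 1) / (N t)\<^sup>2" for t
  define u where "u = tantrix \<gamma>"
  have u: "u t $ i = v t $ i / N t" for t i
    by (simp add: u_def v_def N_def tantrix_nth)
  have nz: "(v t $ 1)\<^sup>2 + (v t $ 2)\<^sup>2 \<noteq> 0" for t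
    using N(1)[of t] N(2)[of t] by auto
  have d1: "((\<lambda>t. u t $ 1) has_real_derivative - (\<kappa> t * u t $ 2)) (at t)" for t
    using normalized_derivative[OF has_vector_derivative_vec_nth[OF hw, of 1]
        has_vector_derivative_vec_nth[OF hw, of 2] nz, of t]
    unfolding u \<kappa>_def N(2) N(3) by simp
  have d2: "((\<lambda>t. u t $ 2) has_real_derivative \<kappa> t * u t $ 1) (at t)" for t
  proof -
    \<comment> \<open>The second coordinate is obtained from \<open>normalized_derivative\<close>
      with the two coordinates exchanged.\<close>
    have N': "N t = sqrt ((v t $ 2)\<^sup>2 + (v t $ 1)\<^sup>2)" for t
      using N(3)[of t] by (simp add: add.commute)
    have nz': "(v t $ 2)\<^sup>2 + (v t $ 1)\<^sup>2 \<noteq> 0"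
      by (metis add.commute nz)
    have "- ((v t $ 2 * w t $ 1 - v t $ 1 * w t $ 2) * a) = (v t $ 1 * w t $ 2 - v t $ 2 * w t $ 1) * a" for a
      by (simp add: algebra_simps)
    then have "- ((v t $ 2 * w t $ 1 - v t $ 1 * w t $ 2) / ((v t $ 2)\<^sup>2 + (v t $ 1)\<^sup>2) * a)
        = \<kappa> t * a" for a
      by (simp add: \<kappa>_def N(2) add.commute divide_inverse mult.assoc)
    then show ?thesis
      using normalized_derivative[OF has_vector_derivative_vec_nth[OF hw, of 2]
        has_vector_derivative_vec_nth[OF hw, of 1] nz']
      unfolding u N' by (simp only:)
  qed
  have \<kappa>0: "\<kappa> t \<noteq> 0" for t
  proof
    assume "\<kappa> t = 0"
    then have "((\<lambda>t. u t $ i) has_real_derivative 0 $ i) (at t)" for i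
      using d1[of t] d2[of t] exhaust_2[of i] by auto
    then have "(u has_vector_derivative 0) (at t)"
      by (rule has_vector_derivative_vecI)
    then have "curvature \<gamma> t = 0"
      by (simp add: curvature_def u_def vector_derivative_at)
    with curv show False by blast
  qed
  have \<kappa>cont: "continuous_on UNIV \<kappa>"
    unfolding \<kappa>_def N_def
    by (intro continuous_intros vcont w) (use v0 in auto)
  have \<kappa>per: "\<kappa> (t + 2 * pi) = \<kappa> t" for t
    by (simp add: \<kappa>_def N_def vper wper)
  have "(u t $ 1)\<^sup>2 + (u t $ 2)\<^sup>2 = 1" for t
    using N[of t] nz[of t] by (simp add: u power_divide flip: add_divide_distrib)
  then obtain \<theta> where \<theta>: "\<And>t. (\<theta> has_real_derivative \<kappa> t) (at t)"
    and cs: "\<And>t. u t $ 1 = cos (\<theta> t)" "\<And>t. u t $ 2 = sin (\<theta> t)"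
    using unit_vector_angle[OF \<kappa>cont d1 d2] by metis
  \<comment> \<open>The factor \<open>sgn\<close> accounts for orientation: if \<kappa> is negative,
    the loop has to be run backwards for the angle to increase, and its tangent direction is then
    opposite to that of \<gamma>.\<close>
  obtain T where T: "surj T" "\<And>x. (T has_real_derivative inverse (\<kappa> (T x))) (at x)"
    "\<And>x. cos (\<theta> (T x)) = sgn (\<kappa> (T x)) * cos x \<and> sin (\<theta> (T x)) = sgn (\<kappa> (T x)) * sin x"
  proof (cases "\<forall>t. \<kappa> t > 0")
    case True
    obtain m where "m > 0" "\<And>x. m \<le> \<kappa> x"
      using positive_periodic_bounded_below[of \<kappa> "2 * pi"] \<kappa>cont \<kappa>per True by auto
    then obtain T where "\<And>x. \<theta> (T x) = x" "\<And>x. T (\<theta> x) = x"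
      "\<And>x. (T has_real_derivative inverse (\<kappa> (T x))) (at x)"
      using increasing_inverse[OF \<theta>] by metis
    moreover from this have "surj T" by (metis surjI)
    ultimately show ?thesis
      using True by (intro that[of T]) auto
  next
    case False
    then have neg: "\<And>t. \<kappa> t < 0"
      using nonvanishing_constant_sign[OF \<kappa>cont \<kappa>0] by blast
    obtain m where "m > 0" "\<And>x. m \<le> - \<kappa> x"
      using positive_periodic_bounded_below[of "\<lambda>x. - \<kappa> x" "2 * pi"] \<kappa>cont \<kappa>per neg
      by (auto intro: continuous_intros)
    moreover have "((\<lambda>x. - \<theta> x) has_real_derivative - \<kappa> x) (at x)" for x
      by (rule DERIV_minus[OF \<theta>])
    ultimately obtain T where T: "\<And>x. - \<theta> (T x) = x" "\<And>x. T (- \<theta> x) = x"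
      "\<And>x. (T has_real_derivative inverse (- \<kappa> (T x))) (at x)"
      using increasing_inverse[of "\<lambda>x. - \<theta> x" "\<lambda>x. - \<kappa> x"] by metis
    \<comment> \<open>\<open>T\<close> inverts \<open>- \<theta>\<close>. The minus sign in the
      argument restores the angle \<theta>, and the shift by \<open>pi\<close> absorbs the reversal
      of the tangent.\<close>
    define T1 where "T1 x = T (- x - pi)" for x
    have "T1 (\<theta> x - pi) = x" for x
      by (simp add: T1_def T(2))
    then have "surj T1" by (rule surjI)
    moreover have "(T1 has_real_derivative inverse (\<kappa> (T1 x))) (at x)" for x
    proof -
      have "((\<lambda>x. - x - pi) has_real_derivative - 1) (at x)"
        by (auto intro!: derivative_eq_intros)
      from DERIV_chain2[OF T(3) this] show ?thesis
        by (simp add: T1_def[abs_def])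
    qed
    moreover have "\<theta> (T1 x) = x + pi" for x
      using T(1)[of "- x - pi"] by (simp add: T1_def)
    ultimately show ?thesis
      using neg by (intro that[of T1]) auto
  qed
  define c where "c x = \<gamma> (T x)" for x
  \<comment> \<open>The radius of curvature: speed divided by angular speed.\<close>
  define \<rho> where "\<rho> x = N (T x) / \<bar>\<kappa> (T x)\<bar>" for x
  have Tcont: "continuous_on UNIV T"
    using T(2) by (meson DERIV_isCont continuous_at_imp_continuous_on)
  have "continuous_on UNIV \<rho>"
    unfolding \<rho>_def N_def
    by (intro continuous_intros continuous_on_compose2[OF vcont] continuous_on_compose2[OF \<kappa>cont] Tcont)
      (use \<kappa>0 in auto)
  moreover have "\<rho> x > 0" for x
    using N(1) \<kappa>0 by (simp add: \<rho>_def)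
  moreover have c: "((\<lambda>x. c x $ i) has_real_derivative v (T x) $ i * inverse (\<kappa> (T x))) (at x)" for x i
    unfolding c_def by (rule DERIV_chain2[OF has_vector_derivative_vec_nth[OF hv] T(2)])
  have vN: "v (T x) $ i = N (T x) * u (T x) $ i" for x i
    using N(1)[of "T x"] by (simp add: u)
  have "((\<lambda>x. c x $ 1) has_real_derivative \<rho> x * cos x) (at x)" for x
    using c[of 1 x] unfolding vN cs using T(3)[of x] \<kappa>0[of "T x"]
    by (cases "\<kappa> (T x) > 0") (simp_all add: \<rho>_def divide_inverse mult_ac)
  moreover have "((\<lambda>x. c x $ 2) has_real_derivative \<rho> x * sin x) (at x)" for x
    using c[of 2 x] unfolding vN cs using T(3)[of x] \<kappa>0[of "T x"]
    by (cases "\<kappa> (T x) > 0") (simp_all add: \<rho>_def divide_inverse mult_ac)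
  moreover have "range c = range \<gamma>"
    using T(1) unfolding c_def by (metis image_image)
  ultimately show ?thesis
    using that by blast
qed

lemma DERIV_shift_argument:
  fixes F :: "real \<Rightarrow> real"
  assumes "(F has_real_derivative d) (at (x + p))"
  shows "((\<lambda>x. F (x + p)) has_real_derivative d) (at x)"
  using assms DERIV_shift[of F _ x p] by simp

lemma primitive_period_increment:
  fixes F :: "real \<Rightarrow> real"
  assumes F: "\<And>x. (F has_real_derivative d x) (at x)" and d: "\<And>x. d (x + p) = d x"
  obtains k where "\<And>x. F (x + p) = F x + k"
proof -
  have "((\<lambda>x. F (x + p) - F x) has_real_derivative 0) (at x)" for x
    using DERIV_diff[OF DERIV_shift_argument[where x = x and p = p, OF F] F] d by simp
  then have "F (x + p) - F x = F (0 + p) - F 0" for x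
    using DERIV_isconst_all by blast
  then show ?thesis
    using that[of "F (0 + p) - F 0"] by (simp add: algebra_simps)
qed

text \<open>A loop may run around its image several times, so closing up after one turn has to come
  from convexity. Every \<open>c x\<close> lies on the frontier of a convex domain, and hence the
  whole curve stays on the left of each of its tangent lines.\<close>

lemma angle_parametrization_periodic:
  fixes c :: "real \<Rightarrow> real^2"
  assumes pos: "\<And>x. \<rho> x > 0"
    and c1: "\<And>x. ((\<lambda>x. c x $ 1) has_real_derivative \<rho> x * cos x) (at x)"
    and c2: "\<And>x. ((\<lambda>x. c x $ 2) has_real_derivative \<rho> x * sin x) (at x)"
    and conv: "bounds_convex_domain (range c)"
  shows "c (x + 2 * pi) = c x"
proof -
  obtain D where D: "open D" "convex D" "frontier D = range c"
    using conv by (auto simp: bounds_convex_domain_def)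
  \<comment> \<open>The signed distance of \<open>c y\<close> from the tangent line at
    \<open>c x\<close>, measured along the left normal (\<open>- sin x\<close>,
    \<open>cos x\<close>).\<close>
  define n where "n x y = (c y $ 2 - c x $ 2) * cos x - (c y $ 1 - c x $ 1) * sin x" for x y
  have dn: "(n x has_real_derivative \<rho> y * sin (y - x)) (at y)" for x y
    unfolding n_def by (rule derivative_eq_intros c1 c2 refl)+ (simp add: sin_diff algebra_simps)
  have support: "n x y \<ge> 0" for x y
  proof -
    \<comment> \<open>The linear functional of a supporting line at \<open>c x\<close> is minimal
      along the curve at parameter \<open>x\<close>. Its derivative vanishes there, so
      \<open>a\<close> is a multiple \<open>l\<close> of the left normal.\<close>
    have "c x \<in> closure D" "c x \<notin> rel_interior D"
      using D by (auto simp: frontier_def rel_interior_open interior_open)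
    then obtain a where a: "a \<noteq> 0" "\<And>z. z \<in> closure D \<Longrightarrow> a \<bullet> c x \<le> a \<bullet> z"
      using supporting_hyperplane_relative_frontier[OF \<open>convex D\<close>] by metis
    define A where "A y = a $ 1 * c y $ 1 + a $ 2 * c y $ 2" for y
    have "c y \<in> closure D" for y
      using D(3) by (auto simp: frontier_def)
    then have min: "A x \<le> A y" for y
      using a(2) by (simp add: A_def inner_vec_def sum_2)
    have "(A has_real_derivative \<rho> x * (a $ 1 * cos x + a $ 2 * sin x)) (at x)"
      unfolding A_def by (rule derivative_eq_intros c1 c2 refl)+ (simp add: algebra_simps)
    then have "\<rho> x * (a $ 1 * cos x + a $ 2 * sin x) = 0"
      by (rule DERIV_local_min[of A _ x 1]) (use min in auto)
    then have orth: "a $ 1 * cos x + a $ 2 * sin x = 0"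
      using pos[of x] by simp
    define l where "l = a $ 2 * cos x - a $ 1 * sin x"
    have "a $ 1 = - l * sin x" "a $ 2 = l * cos x"
      using orth sin_cos_squared_add[of x] unfolding l_def by algebra+
    then have An: "A y - A x = l * n x y" for y
      by (simp add: A_def n_def algebra_simps)
    \<comment> \<open>To fix the sign of \<open>l\<close>, one point strictly to the left of the
      tangent is enough; the curve turns left for the next quarter turn.\<close>
    have "n x x < n x (x + pi / 2)"
    proof (rule DERIV_pos_imp_increasing_open[where f = "n x"])
      show "\<exists>d. (n x has_real_derivative d) (at y) \<and> d > 0" if "x < y" "y < x + pi / 2" for y
        using dn pos sin_gt_zero[of "y - x"] that by (intro exI[of _ "\<rho> y * sin (y - x)"]) auto
    qed (use dn DERIV_isCont continuous_at_imp_continuous_on in auto, blast)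
    then have "n x (x + pi / 2) > 0"
      by (simp add: n_def)
    moreover have "0 \<le> l * n x y" for y
      using min[of y] An[of y] by linarith
    ultimately have "l \<ge> 0"
      by (meson linorder_not_less zero_le_mult_iff)
    moreover have "l \<noteq> 0"
      using \<open>a $ 1 = _\<close> \<open>a $ 2 = _\<close> \<open>a \<noteq> 0\<close> by (auto simp: vec_eq_iff forall_2)
    ultimately show ?thesis
      using \<open>0 \<le> l * n x y\<close> by (simp add: zero_le_mult_iff)
  qed
  \<comment> \<open>The tangent lines at angles \<open>x\<close> and \<open>x + 2\<pi>\<close> are parallel and support the domain from
    the same side, so they coincide; differentiating this along the curve gives the claim.\<close>
  define W where "W x = (c (x + 2 * pi) $ 2 - c x $ 2) * cos x - (c (x + 2 * pi) $ 1 - c x $ 1) * sin x" for x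
  have W0: "W x = 0" for x
    using support[of x "x + 2 * pi"] support[of "x + 2 * pi" x]
    unfolding n_def W_def sin_periodic cos_periodic by (simp add: algebra_simps)
  have sh1: "((\<lambda>x. c (x + 2 * pi) $ 1) has_real_derivative \<rho> (x + 2 * pi) * cos x) (at x)"
    using DERIV_shift_argument[where x = x and p = "2 * pi", OF c1] by simp
  have sh2: "((\<lambda>x. c (x + 2 * pi) $ 2) has_real_derivative \<rho> (x + 2 * pi) * sin x) (at x)"
    using DERIV_shift_argument[where x = x and p = "2 * pi", OF c2] by simp
  \<comment> \<open>The terms with \<rho> cancel because the tangents at both points are parallel.
    What remains is minus the tangential component of \<open>c (x + 2 * pi) - c x\<close>, while
    \<open>W\<close> is its normal component.\<close>
  have "(W has_real_derivative
      - (c (x + 2 * pi) $ 1 - c x $ 1) * cos x - (c (x + 2 * pi) $ 2 - c x $ 2) * sin x) (at x)"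
    unfolding W_def by (rule derivative_eq_intros c1 c2 sh1 sh2 refl)+ (simp add: algebra_simps)
  moreover have "(W has_real_derivative 0) (at x)"
  proof -
    have "W = (\<lambda>x. 0)" using W0 by auto
    then show ?thesis by simp
  qed
  ultimately have "- (c (x + 2 * pi) $ 1 - c x $ 1) * cos x - (c (x + 2 * pi) $ 2 - c x $ 2) * sin x = 0"
    by (rule DERIV_unique)
  moreover have "(c (x + 2 * pi) $ 2 - c x $ 2) * cos x - (c (x + 2 * pi) $ 1 - c x $ 1) * sin x = 0"
    using W0[of x] by (simp add: W_def)
  ultimately have "c (x + 2 * pi) $ 1 - c x $ 1 = 0" "c (x + 2 * pi) $ 2 - c x $ 2 = 0"
    using sin_cos_squared_add[of x] by algebra+
  then show ?thesis
    by (simp add: vec_eq_iff forall_2)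
qed

lemma angle_parametrization_radius_periodic:
  fixes c :: "real \<Rightarrow> real^2"
  assumes c1: "\<And>x. ((\<lambda>x. c x $ 1) has_real_derivative \<rho> x * cos x) (at x)"
    and c2: "\<And>x. ((\<lambda>x. c x $ 2) has_real_derivative \<rho> x * sin x) (at x)"
    and per: "\<And>x. c (x + 2 * pi) = c x"
  shows "\<rho> (x + 2 * pi) = \<rho> x"
proof -
  have "((\<lambda>x. c x $ 1) has_real_derivative \<rho> (x + 2 * pi) * cos x) (at x)"
    using DERIV_shift_argument[where x = x and p = "2 * pi", OF c1] per by simp
  then have 1: "\<rho> (x + 2 * pi) * cos x = \<rho> x * cos x"
    using c1 DERIV_unique by blast
  have "((\<lambda>x. c x $ 2) has_real_derivative \<rho> (x + 2 * pi) * sin x) (at x)"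
    using DERIV_shift_argument[where x = x and p = "2 * pi", OF c2] per by simp
  then have 2: "\<rho> (x + 2 * pi) * sin x = \<rho> x * sin x"
    using c2 DERIV_unique by blast
  from 1 2 sin_cos_squared_add[of x] show ?thesis
    by algebra
qed

text \<open>Equal radii make the velocities at antipodal angles opposite, so
  \<open>c x + c (x + pi)\<close> is constant, and half of it is the centre of symmetry.\<close>

lemma symmetric_if_antipodal_radii_equal:
  fixes c :: "real \<Rightarrow> real^2"
  assumes c1: "\<And>x. ((\<lambda>x. c x $ 1) has_real_derivative \<rho> x * cos x) (at x)"
    and c2: "\<And>x. ((\<lambda>x. c x $ 2) has_real_derivative \<rho> x * sin x) (at x)"
    and eq: "\<And>x. \<rho> (x + pi) = \<rho> x"
  shows "symmetric (range c)"
proof -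
  define m where "m = (c 0 + c pi) /\<^sub>R 2"
  have sh1: "((\<lambda>x. c (x + pi) $ 1) has_real_derivative - (\<rho> x * cos x)) (at x)" for x
    using DERIV_shift_argument[where x = x and p = pi, OF c1] eq by simp
  have sh2: "((\<lambda>x. c (x + pi) $ 2) has_real_derivative - (\<rho> x * sin x)) (at x)" for x
    using DERIV_shift_argument[where x = x and p = pi, OF c2] eq by simp
  have "((\<lambda>x. c x $ 1 + c (x + pi) $ 1) has_real_derivative 0) (at x)" for x
    using DERIV_add[OF c1 sh1] by simp
  then have 1: "c x $ 1 + c (x + pi) $ 1 = c 0 $ 1 + c (0 + pi) $ 1" for x
    using DERIV_isconst_all by blast
  have "((\<lambda>x. c x $ 2 + c (x + pi) $ 2) has_real_derivative 0) (at x)" for x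
    using DERIV_add[OF c2 sh2] by simp
  then have 2: "c x $ 2 + c (x + pi) $ 2 = c 0 $ 2 + c (0 + pi) $ 2" for x
    using DERIV_isconst_all by blast
  have "2 *\<^sub>R m = c x + c (x + pi)" for x
    using 1[of x] 2[of x] by (simp add: m_def vec_eq_iff forall_2)
  then have refl: "2 *\<^sub>R m - c x = c (x + pi)" "2 *\<^sub>R m - c (x + pi) = c x" for x
    by (metis add_diff_cancel_left', metis add_diff_cancel_right')
  have "(\<lambda>x. 2 *\<^sub>R m - x) ` range c = range c"
  proof
    show "(\<lambda>x. 2 *\<^sub>R m - x) ` range c \<subseteq> range c"
      using refl(1) by auto
    show "range c \<subseteq> (\<lambda>x. 2 *\<^sub>R m - x) ` range c"
      using refl(2) by (metis image_subsetI rangeI image_eqI)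
  qed
  then show ?thesis
    unfolding symmetric_def by blast
qed

section \<open>Construction of a periodic height over an asymmetric oval\<close>

text \<open>The slope \<open>1 + \<lambda> Q\<close> has antipodal sum \<open>2\<close> because \<open>Q\<close> is an antiperiodic second primitive of
  \<open>\<rho> x - \<rho> (x + \<pi>)\<close>. Integration by parts turns \<open>\<integral> Q \<rho>\<close> over a period into \<open>- \<integral> P\<^sup>2\<close> over half a
  period, where \<open>P = Q'\<close>; this is nonzero, so \<open>\<lambda>\<close> can be chosen to make the height periodic.\<close>

lemma periodic_height_with_positive_antipodal_sum:
  fixes \<rho> :: "real \<Rightarrow> real"
  assumes cont: "continuous_on UNIV \<rho>" and per: "\<And>x. \<rho> (x + 2 * pi) = \<rho> x"
    and asym: "\<rho> (x0 + pi) \<noteq> \<rho> x0"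
  obtains h f f' where "\<And>x. (h has_real_derivative \<rho> x * f x) (at x)"
    "\<And>x. h (x + 2 * pi) = h x" "\<And>x. f (x + 2 * pi) = f x" "\<And>x. (f has_real_derivative f' x) (at x)"
    "continuous_on UNIV f'" "\<And>x. f x + f (x + pi) > 0"
proof -
  obtain S where S: "\<And>x. (S has_real_derivative \<rho> x) (at x)"
    using real_antiderivative[OF cont] by blast
  obtain L where L: "\<And>x. S (x + 2 * pi) = S x + L"
    using primitive_period_increment[OF S per] by blast
  \<comment> \<open>The constant \<open>L / 2\<close> is the one that makes this primitive change
    sign under a shift by \<open>pi\<close>.\<close>
  define P where "P x = S x - S (x + pi) + L / 2" for x
  have dP: "(P has_real_derivative \<rho> x - \<rho> (x + pi)) (at x)" for x
    unfolding P_def by (rule derivative_eq_intros S DERIV_shift_argument refl)+ simp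
  have Panti: "P (x + pi) = - P x" for x
    using L[of x] by (simp add: P_def add.assoc)
  obtain x1 where x1: "P x1 \<noteq> 0"
  proof -
    have "\<exists>x. P x \<noteq> 0"
    proof (rule ccontr)
      assume "\<nexists>x. P x \<noteq> 0"
      then have "P = (\<lambda>x. 0)" by auto
      then have "(P has_real_derivative 0) (at x0)" by simp
      then show False
        using dP[of x0] DERIV_unique asym by fastforce
    qed
    with that show ?thesis by blast
  qed
  have Pcont: "continuous_on UNIV P"
    using dP by (meson DERIV_isCont continuous_at_imp_continuous_on)
  obtain Q0 where Q0: "\<And>x. (Q0 has_real_derivative P x) (at x)"
    using real_antiderivative[OF Pcont] by blast
  \<comment> \<open>Since \<open>P\<close> is antiperiodic, \<open>Q0 x + Q0 (x + pi)\<close> is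
    constant; subtracting half of that constant makes the primitive antiperiodic as well.\<close>
  define Q where "Q x = Q0 x - (Q0 0 + Q0 pi) / 2" for x
  have dQ: "(Q has_real_derivative P x) (at x)" for x
    unfolding Q_def by (auto intro!: derivative_eq_intros Q0)
  have Qanti: "Q (x + pi) = - Q x" for x
  proof -
    have "((\<lambda>x. Q0 x + Q0 (x + pi)) has_real_derivative 0) (at x)" for x
      using DERIV_add[OF Q0 DERIV_shift_argument[where x = x and p = pi, OF Q0]] Panti by simp
    then have "Q0 x + Q0 (x + pi) = Q0 0 + Q0 (0 + pi)"
      using DERIV_isconst_all by blast
    then show ?thesis
      by (simp add: Q_def field_simps)
  qed
  have Qcont: "continuous_on UNIV Q"
    using dQ by (meson DERIV_isCont continuous_at_imp_continuous_on)
  obtain F where F: "\<And>x. (F has_real_derivative Q x * \<rho> x) (at x)"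
    using real_antiderivative[of "\<lambda>x. Q x * \<rho> x"] Qcont cont continuous_on_mult by blast
  have Qper: "Q (x + 2 * pi) = Q x" for x
    using Qanti[of x] Qanti[of "x + pi"] by (simp add: add.assoc)
  obtain J where J: "\<And>x. F (x + 2 * pi) = F x + J"
    using primitive_period_increment[OF F, of "2 * pi"] Qper per by auto
  have "J \<noteq> 0"
  proof -
    obtain R where R: "\<And>x. (R has_real_derivative (P x)\<^sup>2) (at x)"
      using real_antiderivative[of "\<lambda>x. (P x)\<^sup>2"] Pcont continuous_on_power by blast
    \<comment> \<open>Folding the period in half turns the integrand \<open>Q * \<rho>\<close> into
      \<open>Q\<close> times the derivative of \<open>P\<close>. \<open>V\<close> is integration by
      parts in terms of primitives: it is constant, and \<open>Q * P\<close> takes equal values at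
      both ends of a half period.\<close>
    define V where "V x = F x + F (x + pi) - Q x * P x + R x" for x
    have "(V has_real_derivative 0) (at x)" for x
      unfolding V_def
      by (rule derivative_eq_intros F DERIV_shift_argument[OF F] dQ dP R refl)+
        (simp only: Qanti, simp add: algebra_simps power2_eq_square)
    then have "V (x1 + pi) = V x1"
      using DERIV_isconst_all by blast
    then have JR: "J = R x1 - R (x1 + pi)"
      using J[of x1] by (simp add: V_def Qanti Panti add.assoc)
    \<comment> \<open>The half period starts where \<open>P\<close> is nonzero, so \<open>R\<close>
      increases strictly at once and never decreases afterwards.\<close>
    have "(P x1)\<^sup>2 > 0"
      using x1 by simp
    then obtain d where d: "d > 0" "\<And>h. 0 < h \<Longrightarrow> h < d \<Longrightarrow> R x1 < R (x1 + h)"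
      using DERIV_pos_inc_right[OF R] by blast
    define h where "h = min (d / 2) pi"
    have h: "0 < h" "h < d" "h \<le> pi"
      using d(1) pi_gt_zero by (auto simp: h_def min_def)
    have "R (x1 + h) \<le> R (x1 + pi)"
    proof (rule DERIV_nonneg_imp_nondecreasing[where f = R])
      show "\<exists>y. (R has_real_derivative y) (at x) \<and> 0 \<le> y" for x
        using R zero_le_power2 by blast
    qed (use h(3) in simp)
    with d(2)[OF h(1,2)] show ?thesis
      unfolding JR by simp
  qed
  \<comment> \<open>Over a period \<open>S + l * F\<close> grows by \<open>L + l * J\<close>, which
    this choice makes zero.\<close>
  define l where "l = - L / J"
  show ?thesis
  proof (rule that)
    show "((\<lambda>x. S x + l * F x) has_real_derivative \<rho> x * (1 + l * Q x)) (at x)" for x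
      by (rule derivative_eq_intros S F refl)+ (simp add: algebra_simps)
    show "S (x + 2 * pi) + l * F (x + 2 * pi) = S x + l * F x" for x
      using \<open>J \<noteq> 0\<close> unfolding L J by (simp add: l_def algebra_simps)
    show "1 + l * Q (x + 2 * pi) = 1 + l * Q x" for x
      by (simp add: Qper)
    show "((\<lambda>x. 1 + l * Q x) has_real_derivative l * P x) (at x)" for x
      by (auto intro!: derivative_eq_intros dQ)
    show "continuous_on UNIV (\<lambda>x. l * P x)"
      by (intro continuous_intros Pcont)
    show "(1 + l * Q x) + (1 + l * Q (x + pi)) > 0" for x
      by (simp add: Qanti)
  qed
qed

section \<open>Lifting the oval to a skew loop in the cylinder\<close>

lemma continuous_on_vecI:
  fixes f :: "real \<Rightarrow> real^'n"
  assumes "\<And>i. continuous_on S (\<lambda>t. f t $ i)"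
  shows "continuous_on S f"
  using continuous_on_vec_lambda[of S "\<lambda>i t. f t $ i"] assms by (simp add: vec_lambda_eta)

lemma C_k_2I:
  fixes f :: "real \<Rightarrow> 'a::real_normed_vector"
  assumes "\<And>t. (f has_vector_derivative f1 t) (at t)"
    and "\<And>t. (f1 has_vector_derivative f2 t) (at t)"
    and "continuous_on UNIV f2"
  shows "C_k 2 f"
proof -
  have "velocity f = f1" "velocity f1 = f2"
    using assms(1,2) by (simp_all add: vector_derivative_at fun_eq_iff)
  with assms show ?thesis
    by (auto simp: numeral_2_eq_2 intro: differentiableI_vector)
qed

text \<open>With the arclength of the base curve as parameter, \<rho> cancels from the velocity,
  which is proportional to (\<open>cos \<Theta>\<close>, \<open>sin \<Theta>\<close>,
  \<open>f \<Theta>\<close>) and can be differentiated again. Curvature cannot vanish because the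
  horizontal direction keeps turning.\<close>

lemma skew_loop_over_angle_parametrization:
  fixes c :: "real \<Rightarrow> real^2"
  assumes cont: "continuous_on UNIV \<rho>" and pos: "\<And>x. \<rho> x > 0"
    and c1: "\<And>x. ((\<lambda>x. c x $ 1) has_real_derivative \<rho> x * cos x) (at x)"
    and c2: "\<And>x. ((\<lambda>x. c x $ 2) has_real_derivative \<rho> x * sin x) (at x)"
    and cper: "\<And>x. c (x + 2 * pi) = c x"
    and h: "\<And>x. (h has_real_derivative \<rho> x * f x) (at x)"
    and hper: "\<And>x. h (x + 2 * pi) = h x"
    and fper: "\<And>x. f (x + 2 * pi) = f x"
    and f: "\<And>x. (f has_real_derivative f' x) (at x)" and f': "continuous_on UNIV f'"
    and sum: "\<And>x. f x + f (x + pi) > 0"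
  shows "\<exists>G :: real \<Rightarrow> real^3. immersed_loop 2 G \<and> range G \<subseteq> cylinder (range c) \<and> skew G
           \<and> (\<forall>t. curvature G t \<noteq> 0)"
proof -
  have \<rho>per: "\<rho> (x + 2 * pi) = \<rho> x" for x
    by (rule angle_parametrization_radius_periodic[where c = c, OF c1 c2 cper])
  obtain S where S: "\<And>x. (S has_real_derivative \<rho> x) (at x)"
    using real_antiderivative[OF cont] by blast
  obtain L where L: "\<And>x. S (x + 2 * pi) = S x + L"
    using primitive_period_increment[OF S \<rho>per] by blast
  have "S 0 < S (0 + 2 * pi)"
    by (rule DERIV_pos_imp_increasing) (use S pos in auto)
  then have "L > 0"
    unfolding L by simp
  \<comment> \<open>Rescales the length \<open>L\<close> of one turn to
    \<open>2 * pi\<close>.\<close>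
  define a where "a = 2 * pi / L"
  have a: "a > 0" "a * L = 2 * pi"
    using \<open>L > 0\<close> by (auto simp: a_def)
  obtain m where m: "m > 0" "\<And>x. m \<le> \<rho> x"
    using positive_periodic_bounded_below[OF cont pos \<rho>per] by auto
  obtain \<Theta> where \<Theta>: "\<And>s. a * S (\<Theta> s) = s" "\<And>x. \<Theta> (a * S x) = x"
    "\<And>s. (\<Theta> has_real_derivative inverse (a * \<rho> (\<Theta> s))) (at s)"
    using increasing_inverse[OF DERIV_cmult[OF S, of a], of "a * m"] m a(1) by auto
  have \<Theta>per: "\<Theta> (s + 2 * pi) = \<Theta> s + 2 * pi" for s
  proof -
    have "a * S (\<Theta> s + 2 * pi) = s + 2 * pi"
      unfolding L by (simp add: distrib_left a(2) \<Theta>(1))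
    then show ?thesis
      by (metis \<Theta>(2))
  qed
  have \<Theta>cont: "continuous_on UNIV \<Theta>"
    using \<Theta>(3) by (meson DERIV_isCont continuous_at_imp_continuous_on)
  define \<omega> where "\<omega> s = inverse (a * \<rho> (\<Theta> s))" for s
  have \<omega>: "\<omega> s > 0" "\<rho> (\<Theta> s) * \<omega> s = inverse a" for s
    using a(1) pos[of "\<Theta> s"] by (auto simp: \<omega>_def)
  have d\<Theta>: "(\<Theta> has_real_derivative \<omega> s) (at s)" for s
    unfolding \<omega>_def by (rule \<Theta>(3))
  define G :: "real \<Rightarrow> real^3" where "G s = vector [c (\<Theta> s) $ 1, c (\<Theta> s) $ 2, h (\<Theta> s)]" for s
  define G1 :: "real \<Rightarrow> real^3" where
    "G1 s = inverse a *\<^sub>R vector [cos (\<Theta> s), sin (\<Theta> s), f (\<Theta> s)]" for s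
  define G2 :: "real \<Rightarrow> real^3" where
    "G2 s = (inverse a * \<omega> s) *\<^sub>R vector [- sin (\<Theta> s), cos (\<Theta> s), f' (\<Theta> s)]" for s
  \<comment> \<open>The factor \<rho> from differentiating by angle and the angular speed \<omega>
    multiply to the constant \<open>inverse a\<close>.\<close>
  have chain: "((\<lambda>s. F (\<Theta> s)) has_real_derivative inverse a * d (\<Theta> s)) (at s)"
    if "\<And>x. (F has_real_derivative \<rho> x * d x) (at x)" for F d s
    using DERIV_chain2[OF that d\<Theta>] by (rule DERIV_cong) (metis \<omega>(2) mult.assoc mult.commute)
  have dG: "(G has_vector_derivative G1 s) (at s)" for s
  proof (rule has_vector_derivative_vecI)
    fix i :: 3
    consider "i = 1" | "i = 2" | "i = 3" using exhaust_3 by blast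
    then show "((\<lambda>t. G t $ i) has_real_derivative G1 s $ i) (at s)"
      by cases (simp_all add: G_def G1_def chain[OF c1] chain[OF c2] chain[OF h])
  qed
  have dG1: "(G1 has_vector_derivative G2 s) (at s)" for s
  proof (rule has_vector_derivative_vecI)
    fix i :: 3
    consider "i = 1" | "i = 2" | "i = 3" using exhaust_3 by blast
    then show "((\<lambda>t. G1 t $ i) has_real_derivative G2 s $ i) (at s)"
    proof cases
      case 1
      then show ?thesis
        by (simp add: G1_def G2_def) (auto intro!: derivative_eq_intros d\<Theta>)
    next
      case 2
      then show ?thesis
        by (simp add: G1_def G2_def) (auto intro!: derivative_eq_intros d\<Theta>)
    next
      case 3
      then show ?thesis
        using DERIV_cmult[OF DERIV_chain2[OF f d\<Theta>, of s], of "inverse a"]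
        by (simp add: G1_def G2_def mult_ac)
    qed
  qed
  have \<omega>cont: "continuous_on UNIV \<omega>"
    unfolding \<omega>_def by (intro continuous_intros continuous_on_compose2[OF cont] \<Theta>cont)
      (use a(1) pos in \<open>auto simp: less_imp_neq[symmetric]\<close>)
  have G2cont: "continuous_on UNIV G2"
  proof (rule continuous_on_vecI)
    fix i :: 3
    have "continuous_on UNIV (\<lambda>s. f' (\<Theta> s))"
      by (rule continuous_on_compose2[OF f' \<Theta>cont]) simp
    then have "continuous_on UNIV (\<lambda>t. inverse a * \<omega> t * - sin (\<Theta> t))"
      "continuous_on UNIV (\<lambda>t. inverse a * \<omega> t * cos (\<Theta> t))"
      "continuous_on UNIV (\<lambda>t. inverse a * \<omega> t * f' (\<Theta> t))"
      by (intro continuous_intros \<omega>cont \<Theta>cont; assumption)+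
    then show "continuous_on UNIV (\<lambda>t. G2 t $ i)"
      using exhaust_3[of i] by (auto simp: G2_def)
  qed
  have "C_k 2 G"
    by (rule C_k_2I[OF dG dG1 G2cont])
  have vG: "velocity G t = G1 t" for t
    by (rule vector_derivative_at[OF dG])
  have G1nz: "G1 s \<noteq> 0" for s
  proof
    assume "G1 s = 0"
    then have "G1 s $ 1 = 0" "G1 s $ 2 = 0"
      by simp_all
    then have "cos (\<Theta> s) = 0" "sin (\<Theta> s) = 0"
      using a(1) by (simp_all add: G1_def)
    then show False
      using sin_cos_squared_add[of "\<Theta> s"] by simp
  qed
  have loop: "immersed_loop 2 G"
    unfolding immersed_loop_def vG using \<open>C_k 2 G\<close> G1nz by (simp add: G_def \<Theta>per cper hper)
  have cyl: "range G \<subseteq> cylinder (range c)"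
    by (auto simp: cylinder_def G_def)
  have "skew G"
    unfolding skew_def vG
  proof (intro allI impI notI)
    fix t s
    assume nsame: "\<not> same_circle_point t s" and "cross3 (G1 t) (G1 s) = 0"
    then have "cross3 (G1 t) (G1 s) $ i = 0" for i
      by simp
    from this[of 1] this[of 2] this[of 3]
    have cr: "sin (\<Theta> t) * f (\<Theta> s) = f (\<Theta> t) * sin (\<Theta> s)"
      "f (\<Theta> t) * cos (\<Theta> s) = cos (\<Theta> t) * f (\<Theta> s)"
      "cos (\<Theta> t) * sin (\<Theta> s) = sin (\<Theta> t) * cos (\<Theta> s)"
      using a(1) by (simp_all add: cross_components G1_def field_simps)
    \<comment> \<open>Parallel tangents have parallel horizontal parts, so the angles differ by a
      multiple of \<open>pi\<close>. Even multiples give the same circle point; odd ones are the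
      antipodal case.\<close>
    then have "sin (\<Theta> t - \<Theta> s) = 0"
      by (simp add: sin_diff)
    then obtain k :: int where k: "\<Theta> t = \<Theta> s + k * pi"
      unfolding sin_zero_iff_int2 by (auto simp: algebra_simps)
    \<comment> \<open>\<open>periodic_add_int\<close> is applied to the periodic function
      \<open>\<Theta> s - s\<close>.\<close>
    have shift: "\<Theta> (s + 2 * pi * of_int j) = \<Theta> s + 2 * pi * of_int j" for j
      using periodic_add_int[of "\<lambda>s. \<Theta> s - s" "2 * pi" s j] \<Theta>per by simp
    show False
    proof (cases "even k")
      case True
      then obtain j where "k = 2 * j" by (elim evenE)
      then have "\<Theta> t = \<Theta> (s + 2 * pi * of_int j)"
        using k by (simp add: shift)
      then have "t = s + 2 * pi * of_int j"
        by (metis \<Theta>(1))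
      with nsame show False
        by (auto simp: same_circle_point_def)
    next
      case False
      then obtain j where "k = 2 * j + 1" by (elim oddE)
      \<comment> \<open>With \<open>\<Theta> t = y + pi\<close>, the first two components of the
        cross product say that the positive antipodal sum of \<open>f\<close> annihilates both sine
        and cosine.\<close>
      define y where "y = \<Theta> s + 2 * pi * of_int j"
      have \<Theta>t: "\<Theta> t = y + pi"
        using k \<open>k = 2 * j + 1\<close> by (simp add: y_def algebra_simps)
      have y: "f y = f (\<Theta> s)" "sin y = sin (\<Theta> s)" "cos y = cos (\<Theta> s)"
        unfolding y_def by (rule periodic_add_int, simp add: fper)+
      have "sin (\<Theta> s) * (f y + f (y + pi)) = 0" "cos (\<Theta> s) * (f y + f (y + pi)) = 0"
        using cr(1,2) unfolding \<Theta>t by (simp_all add: y algebra_simps)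
      then have "sin (\<Theta> s) = 0" "cos (\<Theta> s) = 0"
        using sum[of y] by auto
      then show False
        using sin_cos_squared_add[of "\<Theta> s"] by simp
    qed
  qed
  moreover have "curvature G s \<noteq> 0" for s
  proof
    assume "curvature G s = 0"
    then have v0: "velocity (tantrix G) s = 0"
      by (simp add: curvature_def)
    define q where "q t = norm (G1 t)" for t
    have q: "q t \<noteq> 0" for t
      using G1nz by (simp add: q_def)
    obtain q' where q': "(q has_real_derivative q') (at s)"
    proof -
      have q_eq: "q t = inverse a * sqrt (1 + (f (\<Theta> t))\<^sup>2)" for t
      proof -
        have "norm (vector [cos (\<Theta> t), sin (\<Theta> t), f (\<Theta> t)] :: real^3) = sqrt (1 + (f (\<Theta> t))\<^sup>2)"
          by (simp add: norm_eq_sqrt_inner inner_vec_def sum_3 flip: power2_eq_square)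
        then show ?thesis
          using a(1) by (simp add: q_def G1_def)
      qed
      have "((\<lambda>t. 1 + (f (\<Theta> t))\<^sup>2) has_real_derivative 2 * f (\<Theta> s) * (f' (\<Theta> s) * \<omega> s)) (at s)"
        by (rule derivative_eq_intros DERIV_chain2[OF f d\<Theta>] refl)+ simp
      from DERIV_cmult[OF DERIV_chain2[OF DERIV_real_sqrt this]] that show ?thesis
        unfolding q_eq[abs_def] by (meson add_pos_nonneg zero_le_power2 zero_less_one)
    qed
    have tan: "tantrix G t = inverse (q t) *\<^sub>R G1 t" for t
      by (simp add: tantrix_def vG q_def)
    \<comment> \<open>A vanishing \<open>velocity\<close> is informative only where a derivative
      exists, so differentiability of the tantrix is established first.\<close>
    have "(tantrix G has_vector_derivative
        inverse (q s) *\<^sub>R G2 s + (- (inverse (q s) * q' * inverse (q s))) *\<^sub>R G1 s) (at s)"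
      unfolding tan[abs_def]
      by (rule has_vector_derivative_scaleR[OF DERIV_inverse'[OF q' q] dG1])
    with v0 have "(tantrix G has_vector_derivative 0) (at s)"
      by (metis vector_derivative_at)
    from has_vector_derivative_vec_nth[OF this, of 1] has_vector_derivative_vec_nth[OF this, of 2]
    have t1: "((\<lambda>t. tantrix G t $ 1) has_real_derivative 0) (at s)"
      and t2: "((\<lambda>t. tantrix G t $ 2) has_real_derivative 0) (at s)" by simp_all
    \<comment> \<open>The component of \<open>G1 t\<close> along the horizontal normal at angle
      \<open>\<Theta> s\<close>. A stationary tantrix makes its derivative at \<open>s\<close> zero,
      since the component itself vanishes there; the turning of the angle makes it
      \<open>inverse a * \<omega> s\<close>.\<close>
    define A where "A t = (tantrix G t $ 2 * cos (\<Theta> s) - tantrix G t $ 1 * sin (\<Theta> s)) * q t" for t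
    have A: "A t = inverse a * sin (\<Theta> t - \<Theta> s)" for t
      using q[of t] a(1) by (simp add: A_def tan G1_def sin_diff field_simps)
    have "(A has_real_derivative 0) (at s)"
      unfolding A_def by (rule derivative_eq_intros t1 t2 q' refl)+ (simp add: tan G1_def)
    moreover have "(A has_real_derivative inverse a * \<omega> s) (at s)"
      unfolding A by (rule derivative_eq_intros d\<Theta> refl)+ simp
    ultimately have "inverse a * \<omega> s = 0"
      using DERIV_unique by blast
    with a(1) \<omega>(1)[of s] show False
      by simp
  qed
  ultimately show ?thesis
    using loop cyl by blast
qed

section \<open>Application to an asymmetric, strictly convex oval\<close>

theorem proposition4p1:
  fixes \<Gamma> :: "(real^2) set"
  assumes "oval 2 \<Gamma>" and "strictly_convex_oval \<Gamma>" and "\<not> symmetric \<Gamma>"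
  shows "\<exists>\<gamma> :: real \<Rightarrow> real^3. immersed_loop 2 \<gamma> \<and> range \<gamma> \<subseteq> cylinder \<Gamma> \<and> skew \<gamma>
           \<and> (\<forall>t. curvature \<gamma> t \<noteq> 0)"
proof -
  obtain \<gamma> where \<gamma>: "immersed_loop 2 \<gamma>" "range \<gamma> = \<Gamma>" "bounds_convex_domain \<Gamma>"
    "\<And>t. curvature \<gamma> t \<noteq> 0"
    using assms(2) by (auto simp: strictly_convex_oval_def oval_parametrization_def)
  obtain c :: "real \<Rightarrow> real^2" and \<rho> where cont: "continuous_on UNIV \<rho>" and pos: "\<And>x. \<rho> x > 0"
    and c1: "\<And>x. ((\<lambda>x. c x $ 1) has_real_derivative \<rho> x * cos x) (at x)"
    and c2: "\<And>x. ((\<lambda>x. c x $ 2) has_real_derivative \<rho> x * sin x) (at x)"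
    and ran: "range c = \<Gamma>"
    using angle_parametrization[OF \<gamma>(1,4)] \<gamma>(2) by metis
  have per: "c (x + 2 * pi) = c x" for x
    using angle_parametrization_periodic[where c = c, OF pos c1 c2] \<gamma>(3) ran by simp
  have \<rho>per: "\<rho> (x + 2 * pi) = \<rho> x" for x
    by (rule angle_parametrization_radius_periodic[where c = c, OF c1 c2 per])
  \<comment> \<open>Asymmetry enters only here: it provides an angle whose radius differs from the
    antipodal one.\<close>
  obtain x0 where "\<rho> (x0 + pi) \<noteq> \<rho> x0"
    using symmetric_if_antipodal_radii_equal[where c = c, OF c1 c2] assms(3) ran by auto
  then obtain h f f' where hf: "\<And>x. (h has_real_derivative \<rho> x * f x) (at x)"
    "\<And>x. h (x + 2 * pi) = h x" "\<And>x. f (x + 2 * pi) = f x"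
    "\<And>x. (f has_real_derivative f' x) (at x)" "continuous_on UNIV f'" "\<And>x. f x + f (x + pi) > 0"
    using periodic_height_with_positive_antipodal_sum[OF cont \<rho>per] by metis
  show ?thesis
    using skew_loop_over_angle_parametrization[where c = c, OF cont pos c1 c2 per hf] unfolding ran .
qed

end
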